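(* Let $X$ be a partially ordered vector space with positive cone $X_+$. The interior of $X_+$ with respect to the order bound topology $\tau_{ob}(X)$ is the set of all order units of $X$, i.e. $$\tau_{ob}\text{-int}(X_+)=\{u\in X;\ u\text{ is an order unit}\}.$$
   Context: A partially ordered vector space is a real vector space $X$ with a partial order $\leq$ such that $x\leq y$ implies $x+z\leq y+z$ and $\lambda x\leq\lambda y$ for all $z\in X$ and real $\lambda\geq 0$; $X_+=\{x\in X;\ x\geq 0\}$, and order intervals are the sets $[x,y]=\{z\in X;\ x\leq z\leq y\}$. An element $u\in X_+$ is an order unit if for every $x\in X$ there is $n\in\mathbb{N}$ with $x\leq nu$. A set $M\subseteq X$ is circled if $\lambda M\subseteq M$ for all $\lambda\in[-1,1]$; $M$ absorbs $N\subseteq X$ if there is $\mu>0$ with $\lambda N\subseteq M$ for all $\lambda\in[-\mu,\mu]$. Let $\mathcal{B}_{ob}(X)$ be the set of all convex, circled $V\subseteq X$ that absorb all order intervals. The order bound topology $\tau_{ob}(X)$ is the vector space topology on $X$ for which $\mathcal{B}_{ob}(X)$ is a base of neighbourhoods at $0$. *)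

theory Defs
  imports "HOL-Analysis.Analysis"
begin

(* Partially ordered vector spaces are the types of class ordered_real_vector. The axiom
   scaleR_right_mono of that class follows from the others: if 0 <= x and a <= b, then
   0 <= (b - a) x. *)

definition order_unit :: "'a::ordered_real_vector \<Rightarrow> bool" where
  "order_unit u \<longleftrightarrow> 0 \<le> u \<and> (\<forall>x. \<exists>n::nat. x \<le> of_nat n *\<^sub>R u)"

definition circled :: "'a::real_vector set \<Rightarrow> bool" where
  "circled M \<longleftrightarrow> (\<forall>c::real. c \<in> {-1..1} \<longrightarrow> (\<lambda>x. c *\<^sub>R x) ` M \<subseteq> M)"

definition absorbs :: "'a::real_vector set \<Rightarrow> 'a set \<Rightarrow> bool" where
  "absorbs M N \<longleftrightarrow> (\<exists>m::real. m > 0 \<and> (\<forall>c\<in>{-m..m}. (\<lambda>x. c *\<^sub>R x) ` N \<subseteq> M))"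

definition ob_base :: "'a::ordered_real_vector set set" where
  "ob_base = {V. convex V \<and> circled V \<and> (\<forall>x y. absorbs V {x..y})}"

(* No separation axiom is required. *)
definition vector_topology :: "'a::real_vector topology \<Rightarrow> bool" where
  "vector_topology T \<longleftrightarrow> topspace T = UNIV \<and>
     continuous_map (prod_topology T T) T (\<lambda>(x, y). x + y) \<and>
     continuous_map (prod_topology euclideanreal T) T (\<lambda>(c, x). c *\<^sub>R x)"

(* Neighbourhoods need not be open. Unlike the library's neighbourhood_base_at, every member
   of the base is required to be a neighbourhood. *)
definition nhood_base :: "'a topology \<Rightarrow> 'a \<Rightarrow> 'a set set \<Rightarrow> bool" where
  "nhood_base T a B \<longleftrightarrow>
     (\<forall>V\<in>B. \<exists>U. openin T U \<and> a \<in> U \<and> U \<subseteq> V) \<and>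
     (\<forall>U. openin T U \<and> a \<in> U \<longrightarrow> (\<exists>V\<in>B. V \<subseteq> U))"

(* Well defined by order_bound_topology_ex1 below. *)
definition order_bound_topology :: "'a::ordered_real_vector topology" where
  "order_bound_topology = (THE T. vector_topology T \<and> nhood_base T 0 ob_base)"

lemma circledD: "circled V \<Longrightarrow> x \<in> V \<Longrightarrow> \<bar>c\<bar> \<le> 1 \<Longrightarrow> c *\<^sub>R x \<in> V"
  unfolding circled_def by (auto simp: abs_le_iff image_subset_iff)

lemma absorbsE:
  assumes "absorbs V N"
  obtains m where "m > 0" "\<And>c x. \<bar>c\<bar> \<le> m \<Longrightarrow> x \<in> N \<Longrightarrow> c *\<^sub>R x \<in> V"
  using assms unfolding absorbs_def by (auto simp: abs_le_iff image_subset_iff)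

lemma absorbsI:
  assumes "m > 0" "\<And>c x. \<bar>c\<bar> \<le> m \<Longrightarrow> x \<in> N \<Longrightarrow> c *\<^sub>R x \<in> V"
  shows "absorbs V N"
  unfolding absorbs_def using assms by (intro exI[of _ m]) (auto simp: abs_le_iff)

lemma ob_base_absorbs_point:
  assumes "V \<in> ob_base"
  obtains m where "m > 0" "\<And>c. \<bar>c\<bar> \<le> m \<Longrightarrow> c *\<^sub>R x \<in> V"
proof -
  from assms have "absorbs V {x..x}" unfolding ob_base_def by blast
  then show ?thesis using that by (elim absorbsE) simp
qed

lemma ob_base_0: "V \<in> ob_base \<Longrightarrow> 0 \<in> V"
  by (metis abs_zero less_imp_le ob_base_absorbs_point scaleR_zero_left)

lemma ob_base_circled: "V \<in> ob_base \<Longrightarrow> x \<in> V \<Longrightarrow> \<bar>c\<bar> \<le> 1 \<Longrightarrow> c *\<^sub>R x \<in> V"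
  by (auto simp: ob_base_def intro: circledD)

lemma ob_base_Int:
  assumes "V \<in> ob_base" "W \<in> ob_base"
  shows "V \<inter> W \<in> ob_base"
proof -
  have "absorbs (V \<inter> W) {x..y}" for x y
  proof -
    from assms have "absorbs V {x..y}" "absorbs W {x..y}" by (auto simp: ob_base_def)
    then obtain m n where "m > 0" "n > 0"
      and "\<And>c z. \<bar>c\<bar> \<le> m \<Longrightarrow> z \<in> {x..y} \<Longrightarrow> c *\<^sub>R z \<in> V"
      and "\<And>c z. \<bar>c\<bar> \<le> n \<Longrightarrow> z \<in> {x..y} \<Longrightarrow> c *\<^sub>R z \<in> W"
      by (metis absorbsE)
    then show ?thesis by (intro absorbsI[of "min m n"]) auto
  qed
  then show ?thesis using assms
    by (auto simp: ob_base_def circled_def image_subset_iff intro!: convex_Int)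
qed

lemma ob_base_scale:
  assumes "V \<in> ob_base" "r > 0"
  shows "(\<lambda>x. r *\<^sub>R x) ` V \<in> ob_base"
proof -
  have "absorbs ((\<lambda>x. r *\<^sub>R x) ` V) {x..y}" for x y
  proof -
    from assms have "absorbs V {x..y}" by (auto simp: ob_base_def)
    then obtain m where m: "m > 0" "\<And>c z. \<bar>c\<bar> \<le> m \<Longrightarrow> z \<in> {x..y} \<Longrightarrow> c *\<^sub>R z \<in> V"
      by (metis absorbsE)
    show ?thesis
    proof (rule absorbsI)
      show "r * m > 0" using assms m by simp
      fix c z assume c: "\<bar>c\<bar> \<le> r * m" and z: "z \<in> {x..y}"
      have "\<bar>c / r\<bar> \<le> m" using c assms by (simp add: abs_divide field_simps)
      from m(2)[OF this z] have "(c / r) *\<^sub>R z \<in> V" .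
      moreover have "c *\<^sub>R z = r *\<^sub>R ((c / r) *\<^sub>R z)" using assms by simp
      ultimately show "c *\<^sub>R z \<in> (\<lambda>x. r *\<^sub>R x) ` V" by (rule rev_image_eqI)
    qed
  qed
  moreover have "circled ((\<lambda>x. r *\<^sub>R x) ` V)"
    unfolding circled_def image_subset_iff
  proof safe
    fix c :: real and v assume "c \<in> {-1..1}" "v \<in> V"
    then have "c *\<^sub>R v \<in> V" using assms(1) by (auto intro: ob_base_circled)
    then show "c *\<^sub>R r *\<^sub>R v \<in> (\<lambda>x. r *\<^sub>R x) ` V"
      by (rule rev_image_eqI) (simp add: mult.commute)
  qed
  ultimately show ?thesis using assms by (auto simp: ob_base_def intro: convex_scaling)
qed

lemma ob_base_half:
  assumes "V \<in> ob_base"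
  obtains W where "W \<in> ob_base" "\<And>x y. x \<in> W \<Longrightarrow> y \<in> W \<Longrightarrow> x + y \<in> V"
proof
  show "(\<lambda>x. (1/2) *\<^sub>R x) ` V \<in> ob_base" using assms by (rule ob_base_scale) simp
  fix x y assume "x \<in> (\<lambda>x. (1/2) *\<^sub>R x) ` V" "y \<in> (\<lambda>x. (1/2) *\<^sub>R x) ` V"
  then show "x + y \<in> V"
    using assms by (auto simp: ob_base_def intro: convexD)
qed

lemma ob_base_UNIV: "UNIV \<in> ob_base"
  by (auto simp: ob_base_def circled_def intro: absorbsI[of 1])

definition ob_open :: "'a::ordered_real_vector set \<Rightarrow> bool" where
  "ob_open U \<longleftrightarrow> (\<forall>x\<in>U. \<exists>V\<in>ob_base. (\<lambda>v. x + v) ` V \<subseteq> U)"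

lemma ob_openin:
  "openin (topology ob_open) = (ob_open :: 'a::ordered_real_vector set \<Rightarrow> bool)"
proof (rule topology_inverse')
  show "istopology (ob_open :: 'a set \<Rightarrow> bool)" unfolding istopology_def
  proof (intro conjI allI impI)
    fix S T :: "'a set" assume "ob_open S" "ob_open T"
    show "ob_open (S \<inter> T)" unfolding ob_open_def
    proof
      fix x assume "x \<in> S \<inter> T"
      then obtain V W where "V \<in> ob_base" "W \<in> ob_base"
        "(\<lambda>v. x + v) ` V \<subseteq> S" "(\<lambda>v. x + v) ` W \<subseteq> T"
        using \<open>ob_open S\<close> \<open>ob_open T\<close> unfolding ob_open_def by blast
      then show "\<exists>V\<in>ob_base. (\<lambda>v. x + v) ` V \<subseteq> S \<inter> T"
        by (intro bexI[of _ "V \<inter> W"] ob_base_Int) auto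
    qed
  next
    fix K :: "'a set set" assume K: "\<forall>S\<in>K. ob_open S"
    show "ob_open (\<Union>K)" unfolding ob_open_def
    proof
      fix x assume "x \<in> \<Union>K"
      then obtain S where S: "S \<in> K" "x \<in> S" by blast
      then obtain V where "V \<in> ob_base" "(\<lambda>v. x + v) ` V \<subseteq> S"
        using K unfolding ob_open_def by blast
      then show "\<exists>V\<in>ob_base. (\<lambda>v. x + v) ` V \<subseteq> \<Union>K" using S by blast
    qed
  qed
qed

lemma ob_open_nhood:
  assumes "V \<in> ob_base"
  obtains U where "ob_open U" "x \<in> U" "U \<subseteq> (\<lambda>v. x + v) ` V"
proof
  let ?U = "{y. \<exists>W\<in>ob_base. (\<lambda>w. y + w) ` W \<subseteq> (\<lambda>v. x + v) ` V}"
  show "ob_open ?U" unfolding ob_open_def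
  proof
    fix y assume "y \<in> ?U"
    then obtain W where W: "W \<in> ob_base" "(\<lambda>w. y + w) ` W \<subseteq> (\<lambda>v. x + v) ` V" by blast
    obtain W' where W': "W' \<in> ob_base" "\<And>a b. a \<in> W' \<Longrightarrow> b \<in> W' \<Longrightarrow> a + b \<in> W"
      using ob_base_half[OF W(1)] by blast
    have "y + a \<in> ?U" if "a \<in> W'" for a
    proof -
      have "(\<lambda>w. y + a + w) ` W' \<subseteq> (\<lambda>w. y + w) ` W"
        using W'(2)[OF that] by (auto simp: add.assoc)
      then show ?thesis using W(2) W'(1) by blast
    qed
    then show "\<exists>V\<in>ob_base. (\<lambda>v. y + v) ` V \<subseteq> ?U" using W'(1) by blast
  qed
  show "x \<in> ?U" using assms by blast
  show "?U \<subseteq> (\<lambda>v. x + v) ` V"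
  proof
    fix y assume "y \<in> ?U"
    then obtain W where W: "W \<in> ob_base" "(\<lambda>w. y + w) ` W \<subseteq> (\<lambda>v. x + v) ` V" by blast
    have "y + 0 \<in> (\<lambda>w. y + w) ` W" using ob_base_0[OF W(1)] by blast
    then show "y \<in> (\<lambda>v. x + v) ` V" using W(2) by auto
  qed
qed

lemma ob_topspace: "topspace (topology ob_open) = UNIV"
proof -
  have "ob_open UNIV" using ob_base_UNIV unfolding ob_open_def by blast
  then show ?thesis by (metis ob_openin openin_subset top.extremum_uniqueI)
qed

lemma ob_add_continuous:
  "continuous_map (prod_topology (topology ob_open) (topology ob_open)) (topology ob_open)
     (\<lambda>(x, y). x + y)"
  unfolding continuous_map_def openin_prod_topology_alt
proof (intro conjI allI impI)
  fix U :: "'a set" and x y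
  assume U: "openin (topology ob_open) U"
    and "(x, y) \<in> {p \<in> topspace (prod_topology (topology ob_open) (topology ob_open)).
              (case p of (x, y) \<Rightarrow> x + y) \<in> U}"
  then have "ob_open U" "x + y \<in> U" by (auto simp: ob_openin)
  then obtain V where V: "V \<in> ob_base" "(\<lambda>v. x + y + v) ` V \<subseteq> U"
    unfolding ob_open_def by blast
  obtain W where W: "W \<in> ob_base" "\<And>a b. a \<in> W \<Longrightarrow> b \<in> W \<Longrightarrow> a + b \<in> V"
    using ob_base_half[OF V(1)] by blast
  obtain A where A: "ob_open A" "x \<in> A" "A \<subseteq> (\<lambda>v. x + v) ` W" by (rule ob_open_nhood[OF W(1)])
  obtain B where B: "ob_open B" "y \<in> B" "B \<subseteq> (\<lambda>v. y + v) ` W" by (rule ob_open_nhood[OF W(1)])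
  have "a + b \<in> U" if "a \<in> A" "b \<in> B" for a b
  proof -
    from that A(3) B(3) obtain v w where vw: "a = x + v" "b = y + w" "v \<in> W" "w \<in> W" by blast
    then have "x + y + (v + w) \<in> U" using V(2) W(2) by blast
    then show ?thesis using vw by (simp add: algebra_simps)
  qed
  then show "\<exists>A B. openin (topology ob_open) A \<and> openin (topology ob_open) B \<and> x \<in> A \<and> y \<in> B \<and>
      A \<times> B \<subseteq> {p \<in> topspace (prod_topology (topology ob_open) (topology ob_open)).
              (case p of (x, y) \<Rightarrow> x + y) \<in> U}"
    using A B by (intro exI[of _ A] exI[of _ B]) (auto simp: ob_openin ob_topspace)
qed (simp add: ob_topspace)

lemma ob_scale_continuous:
  "continuous_map (prod_topology euclideanreal (topology ob_open)) (topology ob_open)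
     (\<lambda>(c, x). c *\<^sub>R x)"
  unfolding continuous_map_def openin_prod_topology_alt
proof (intro conjI allI impI)
  fix U :: "'a set" and c :: real and x
  assume U: "openin (topology ob_open) U"
    and "(c, x) \<in> {p \<in> topspace (prod_topology euclideanreal (topology ob_open)).
              (case p of (c, x) \<Rightarrow> c *\<^sub>R x) \<in> U}"
  then have "ob_open U" "c *\<^sub>R x \<in> U" by (auto simp: ob_openin)
  then obtain V where V: "V \<in> ob_base" "(\<lambda>v. c *\<^sub>R x + v) ` V \<subseteq> U"
    unfolding ob_open_def by blast
  obtain W where W: "W \<in> ob_base" "\<And>a b. a \<in> W \<Longrightarrow> b \<in> W \<Longrightarrow> a + b \<in> V"
    using ob_base_half[OF V(1)] by blast
  obtain m where m: "m > 0" "\<And>t. \<bar>t\<bar> \<le> m \<Longrightarrow> t *\<^sub>R x \<in> W"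
    using ob_base_absorbs_point[OF W(1), of x] by blast
  define d where "d = min m 1"
  define r where "r = inverse (\<bar>c\<bar> + 1)"
  have r: "r > 0" unfolding r_def by (simp add: add_nonneg_pos)
  obtain B where B: "ob_open B" "x \<in> B" "B \<subseteq> (\<lambda>v. x + v) ` (\<lambda>x. r *\<^sub>R x) ` W"
    by (rule ob_open_nhood[OF ob_base_scale[OF W(1) r]])
  have "b *\<^sub>R y \<in> U" if "b \<in> ball c d" "y \<in> B" for b y
  proof -
    from that B(3) obtain w where w: "y = x + r *\<^sub>R w" "w \<in> W" by blast
    have bc: "\<bar>b - c\<bar> < m" "\<bar>b - c\<bar> < 1" using that(1) by (auto simp: d_def dist_real_def)
    have "\<bar>b\<bar> \<le> \<bar>c\<bar> + 1" using bc(2) by linarith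
    then have "\<bar>b\<bar> / (\<bar>c\<bar> + 1) \<le> 1" by (simp add: divide_le_eq_1 add_nonneg_pos)
    then have "\<bar>b * r\<bar> \<le> 1" by (simp add: r_def abs_mult divide_inverse)
    then have "(b * r) *\<^sub>R w \<in> W" using W(1) w(2) by (intro ob_base_circled)
    moreover have "(b - c) *\<^sub>R x \<in> W" using bc m by simp
    ultimately have "c *\<^sub>R x + ((b - c) *\<^sub>R x + (b * r) *\<^sub>R w) \<in> U" using V(2) W(2) by blast
    then show ?thesis using w by (simp add: algebra_simps)
  qed
  moreover have "d > 0" using m by (simp add: d_def)
  ultimately show "\<exists>A B. openin euclideanreal A \<and> openin (topology ob_open) B \<and> c \<in> A \<and> x \<in> B \<and>
      A \<times> B \<subseteq> {p \<in> topspace (prod_topology euclideanreal (topology ob_open)).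
              (case p of (c, x) \<Rightarrow> c *\<^sub>R x) \<in> U}"
    using B by (intro exI[of _ "ball c d"] exI[of _ B]) (auto simp: ob_openin ob_topspace)
qed (simp add: ob_topspace)

lemma ob_nhood_base: "nhood_base (topology ob_open) 0 ob_base"
  unfolding nhood_base_def ob_openin
proof (intro conjI ballI allI impI)
  fix V :: "'a set" assume "V \<in> ob_base"
  from ob_open_nhood[OF this, of 0] obtain U where "ob_open U" "0 \<in> U" "U \<subseteq> (\<lambda>v. 0 + v) ` V" .
  then show "\<exists>U. ob_open U \<and> 0 \<in> U \<and> U \<subseteq> V" by auto
next
  fix U :: "'a set" assume "ob_open U \<and> 0 \<in> U"
  then obtain V where "V \<in> ob_base" "(\<lambda>v. 0 + v) ` V \<subseteq> U" unfolding ob_open_def by blast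
  then show "\<exists>V\<in>ob_base. V \<subseteq> U" by auto
qed

lemma vector_topology_translate:
  assumes "vector_topology T" "openin T U"
  shows "openin T {y. x + y \<in> U}"
proof -
  have ts: "topspace T = UNIV" using assms(1) by (simp add: vector_topology_def)
  have "continuous_map T (prod_topology T T) (\<lambda>y. (x, y))"
    by (auto simp: continuous_map_pairwise o_def ts)
  then have "continuous_map T T ((\<lambda>(x, y). x + y) \<circ> (\<lambda>y. (x, y)))"
    using assms(1) unfolding vector_topology_def by (blast intro: continuous_map_compose)
  from openin_continuous_map_preimage[OF this assms(2)] show ?thesis by (simp add: ts o_def)
qed

lemma ob_topology_unique:
  fixes T :: "'a::ordered_real_vector topology"
  assumes T: "vector_topology T" "nhood_base T 0 ob_base"
  shows "T = topology ob_open"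
  unfolding topology_eq ob_openin
proof (intro allI iffI)
  fix U :: "'a set" assume U: "openin T U"
  show "ob_open U" unfolding ob_open_def
  proof
    fix x assume "x \<in> U"
    then have "openin T {y. x + y \<in> U} \<and> 0 \<in> {y. x + y \<in> U}"
      using vector_topology_translate[OF T(1) U] by simp
    then obtain V where "V \<in> ob_base" "V \<subseteq> {y. x + y \<in> U}"
      using T(2) unfolding nhood_base_def by blast
    then show "\<exists>V\<in>ob_base. (\<lambda>v. x + v) ` V \<subseteq> U" by blast
  qed
next
  fix U :: "'a set" assume U: "ob_open U"
  show "openin T U"
  proof (subst openin_subopen, intro ballI)
    fix x assume "x \<in> U"
    then obtain V where V: "V \<in> ob_base" "(\<lambda>v. x + v) ` V \<subseteq> U"
      using U unfolding ob_open_def by blast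
    then obtain G where G: "openin T G" "0 \<in> G" "G \<subseteq> V"
      using T(2) unfolding nhood_base_def by blast
    have "{y. - x + y \<in> G} \<subseteq> U"
    proof clarify
      fix y assume "- x + y \<in> G"
      then have "x + (- x + y) \<in> U" using G(3) V(2) by blast
      then show "y \<in> U" by simp
    qed
    moreover have "openin T {y. - x + y \<in> G}" by (rule vector_topology_translate[OF T(1) G(1)])
    moreover have "x \<in> {y. - x + y \<in> G}" using G by simp
    ultimately show "\<exists>S. openin T S \<and> x \<in> S \<and> S \<subseteq> U" by blast
  qed
qed

lemma order_bound_topology_ex1:
  "\<exists>!T::'a::ordered_real_vector topology. vector_topology T \<and> nhood_base T 0 ob_base"
proof (rule ex1I)
  show "vector_topology (topology (ob_open :: 'a set \<Rightarrow> bool)) \<and>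
      nhood_base (topology (ob_open :: 'a set \<Rightarrow> bool)) 0 ob_base"
    using ob_topspace ob_add_continuous ob_scale_continuous ob_nhood_base
    by (simp add: vector_topology_def)
qed (use ob_topology_unique in blast)

lemma order_bound_topology:
  "vector_topology (order_bound_topology :: 'a::ordered_real_vector topology)"
  "nhood_base (order_bound_topology :: 'a topology) 0 ob_base"
  unfolding order_bound_topology_def
  by (rule theI'[OF order_bound_topology_ex1, THEN conjunct1]
      theI'[OF order_bound_topology_ex1, THEN conjunct2])+

lemma openin_order_bound_topology:
  "openin order_bound_topology U \<longleftrightarrow> (\<forall>x\<in>U. \<exists>V\<in>ob_base. (\<lambda>v. x + v) ` V \<subseteq> U)"
  unfolding ob_topology_unique[OF order_bound_topology] ob_openin ob_open_def ..

end

theory Submission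
  imports Defs
begin

text \<open>A point \<open>u\<close> is interior to the cone iff \<open>u + V\<close> lies in the
  cone for some \<open>V\<close> in \<open>ob_base\<close>
  (\<open>interior_of_order_bound_topology\<close>). Given such a \<open>V\<close>, absorption of
  the point \<open>x\<close> puts \<open>- m *\<^sub>R x\<close> into \<open>V\<close> for some
  \<open>m > 0\<close>, so \<open>m *\<^sub>R x\<close> lies below \<open>u\<close> and
  \<open>u\<close> is an order unit (\<open>order_unitI_ob_base\<close>). Conversely, for an order
  unit \<open>u\<close> the interval \<open>{- u..u}\<close> is itself in \<open>ob_base\<close>
  (\<open>order_unit_interval_in_ob_base\<close>), and its translate by \<open>u\<close> consists of
  positive elements.\<close>

lemma scaleR_symmetric_bounds:
  fixes u z :: "'a::ordered_real_vector"
  assumes "- u \<le> z" "z \<le> u"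
  shows "- (\<bar>c\<bar> *\<^sub>R u) \<le> c *\<^sub>R z" "c *\<^sub>R z \<le> \<bar>c\<bar> *\<^sub>R u"
proof -
  have le: "\<bar>c\<bar> *\<^sub>R z \<le> \<bar>c\<bar> *\<^sub>R u" and ge: "- (\<bar>c\<bar> *\<^sub>R u) \<le> \<bar>c\<bar> *\<^sub>R z"
    using scaleR_left_mono[OF assms(2), of "\<bar>c\<bar>"] scaleR_left_mono[OF assms(1), of "\<bar>c\<bar>"]
    by auto
  \<comment> \<open>The bounds are symmetric about 0, so the sign of \<open>c\<close> does not
    matter.\<close>
  have "c *\<^sub>R z = \<bar>c\<bar> *\<^sub>R z \<or> c *\<^sub>R z = - (\<bar>c\<bar> *\<^sub>R z)"
    by (cases "0 \<le> c") auto
  then show "- (\<bar>c\<bar> *\<^sub>R u) \<le> c *\<^sub>R z" "c *\<^sub>R z \<le> \<bar>c\<bar> *\<^sub>R u"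
    using le ge by (metis minus_le_iff neg_le_iff_le)+
qed

lemma order_unit_pair_bound:
  assumes "order_unit u"
  obtains r :: real where "r > 0" "x \<le> r *\<^sub>R u" "y \<le> r *\<^sub>R u"
proof -
  from assms obtain n k :: nat where nk: "x \<le> of_nat n *\<^sub>R u" "y \<le> of_nat k *\<^sub>R u" and u: "0 \<le> u"
    unfolding order_unit_def by blast
  \<comment> \<open>The summand 1 keeps the bound positive, hence invertible, even if
    \<open>n\<close> and \<open>k\<close> are both 0.\<close>
  let ?r = "real n + real k + 1"
  have "real n *\<^sub>R u \<le> ?r *\<^sub>R u" "real k *\<^sub>R u \<le> ?r *\<^sub>R u"
    using u by (intro scaleR_right_mono; simp)+
  with nk have "x \<le> ?r *\<^sub>R u" "y \<le> ?r *\<^sub>R u" by (blast intro: order_trans)+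
  then show ?thesis by (rule that[rotated]) linarith
qed

text \<open>Every order interval lies in some \<open>{- (r *\<^sub>R u)..r *\<^sub>R u}\<close> with
  \<open>r > 0\<close>, because \<open>u\<close> is an order unit; factors of modulus at most
  \<open>inverse r\<close> then shrink it into \<open>{- u..u}\<close>.\<close>

lemma order_unit_interval_in_ob_base:
  assumes "order_unit u"
  shows "{- u..u} \<in> ob_base"
proof -
  have u: "0 \<le> u" using assms by (simp add: order_unit_def)
  \<comment> \<open>Used twice: \<open>r = 1\<close> gives circledness, a general \<open>r\<close>
    gives absorption.\<close>
  have shrink: "c *\<^sub>R z \<in> {- u..u}" if "- (r *\<^sub>R u) \<le> z" "z \<le> r *\<^sub>R u" "r > 0" "\<bar>c\<bar> \<le> inverse r"
    for c r z
  proof -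
    have "\<bar>c\<bar> * r \<le> 1" using that(3,4) by (simp add: field_simps)
    then have le: "\<bar>c\<bar> *\<^sub>R (r *\<^sub>R u) \<le> u"
      using scaleR_right_mono[of "\<bar>c\<bar> * r" 1 u] u by simp
    then have ge: "- u \<le> - (\<bar>c\<bar> *\<^sub>R (r *\<^sub>R u))" by simp
    from scaleR_symmetric_bounds[OF that(1,2)] show ?thesis
      unfolding atLeastAtMost_iff using order_trans[OF ge] order_trans[OF _ le] by blast
  qed
  have "convex {- u..u}"
  proof (rule convexI)
    fix x y and a b :: real
    assume xy: "x \<in> {- u..u}" "y \<in> {- u..u}" and ab: "0 \<le> a" "0 \<le> b" "a + b = 1"
    have u_split: "a *\<^sub>R u + b *\<^sub>R u = u" using ab by (simp flip: scaleR_left_distrib)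
    have "a *\<^sub>R (- u) + b *\<^sub>R (- u) \<le> a *\<^sub>R x + b *\<^sub>R y" "a *\<^sub>R x + b *\<^sub>R y \<le> a *\<^sub>R u + b *\<^sub>R u"
      using xy ab by (intro add_mono scaleR_left_mono; simp)+
    moreover have "a *\<^sub>R (- u) + b *\<^sub>R (- u) = - (a *\<^sub>R u + b *\<^sub>R u)" by simp
    ultimately show "a *\<^sub>R x + b *\<^sub>R y \<in> {- u..u}"
      unfolding u_split by auto
  qed
  moreover have "circled {- u..u}"
    unfolding circled_def image_subset_iff
    using shrink[where r = 1] by (simp add: abs_le_iff)
  moreover have "absorbs {- u..u} {x..y}" for x y
  proof -
    \<comment> \<open>The upper bound on \<open>- x\<close> is a lower bound on \<open>x\<close>, so
      one \<open>r\<close> encloses the whole interval.\<close>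
    obtain r where r: "r > 0" "- x \<le> r *\<^sub>R u" "y \<le> r *\<^sub>R u"
      by (rule order_unit_pair_bound[OF assms])
    show ?thesis
    proof (rule absorbsI)
      show "inverse r > 0" using r by simp
      fix c z assume c: "\<bar>c\<bar> \<le> inverse r" and "z \<in> {x..y}"
      moreover have "- (r *\<^sub>R u) \<le> x" using r(2) by (subst minus_le_iff)
      ultimately have "- (r *\<^sub>R u) \<le> z" "z \<le> r *\<^sub>R u"
        using r(3) unfolding atLeastAtMost_iff by (blast intro: order_trans)+
      then show "c *\<^sub>R z \<in> {- u..u}" using r(1) c by (rule shrink)
    qed
  qed
  ultimately show ?thesis by (simp add: ob_base_def)
qed

lemma order_unitI_ob_base:
  assumes V: "V \<in> ob_base" and pos: "\<And>v. v \<in> V \<Longrightarrow> 0 \<le> u + v"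
  shows "order_unit u"
  unfolding order_unit_def
proof (intro conjI allI)
  show u: "0 \<le> u" using pos[OF ob_base_0[OF V]] by simp
  fix x
  obtain m where m: "m > 0" "\<And>c. \<bar>c\<bar> \<le> m \<Longrightarrow> c *\<^sub>R x \<in> V"
    using ob_base_absorbs_point[OF V, of x] by blast
  \<comment> \<open>The factor \<open>- m\<close> turns positivity of \<open>u + v\<close> into an
    upper bound on \<open>x\<close>.\<close>
  have "m *\<^sub>R x \<le> u" using pos[OF m(2)[of "- m"]] m(1) by simp
  then have "x \<le> inverse m *\<^sub>R u"
    using scaleR_left_mono[of "m *\<^sub>R x" u "inverse m"] m(1) by simp
  moreover obtain n :: nat where "inverse m \<le> real n" using real_arch_simple by blast
  ultimately have "x \<le> of_nat n *\<^sub>R u" using scaleR_right_mono[OF _ u] order_trans by blast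
  then show "\<exists>n::nat. x \<le> of_nat n *\<^sub>R u" ..
qed

text \<open>Members of \<open>ob_base\<close> need not be open, so from right to left
  \<open>ob_open_nhood\<close> supplies an open set around \<open>x\<close> inside the translate of
  \<open>V\<close>.\<close>

lemma interior_of_order_bound_topology:
  "x \<in> order_bound_topology interior_of S \<longleftrightarrow> (\<exists>V\<in>ob_base. (\<lambda>v. x + v) ` V \<subseteq> S)"
proof
  assume "x \<in> order_bound_topology interior_of S"
  then obtain U where U: "openin order_bound_topology U" "x \<in> U" "U \<subseteq> S"
    unfolding interior_of_def by auto
  from U(1,2) obtain V where "V \<in> ob_base" "(\<lambda>v. x + v) ` V \<subseteq> U"
    unfolding openin_order_bound_topology by meson
  with U(3) show "\<exists>V\<in>ob_base. (\<lambda>v. x + v) ` V \<subseteq> S" by (meson subset_trans)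
next
  assume "\<exists>V\<in>ob_base. (\<lambda>v. x + v) ` V \<subseteq> S"
  then obtain V where V: "V \<in> ob_base" "(\<lambda>v. x + v) ` V \<subseteq> S" by meson
  obtain U where U: "ob_open U" "x \<in> U" "U \<subseteq> (\<lambda>v. x + v) ` V"
    by (rule ob_open_nhood[OF V(1)])
  have "openin order_bound_topology U"
    unfolding openin_order_bound_topology using U(1) unfolding ob_open_def .
  moreover have "U \<subseteq> S" using U(3) V(2) by (rule subset_trans)
  ultimately show "x \<in> order_bound_topology interior_of S"
    using U(2) unfolding interior_of_def by auto
qed

theorem proposition7p7:
  shows "order_bound_topology interior_of {x :: 'a::ordered_real_vector. 0 \<le> x}
    = {u. order_unit u}"
proof (intro set_eqI iffI)
  fix u :: 'a
  assume "u \<in> order_bound_topology interior_of {x. 0 \<le> x}"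
  then show "u \<in> {u. order_unit u}"
    unfolding interior_of_order_bound_topology using order_unitI_ob_base by blast
next
  fix u :: 'a
  assume "u \<in> {u. order_unit u}"
  then have "{- u..u} \<in> ob_base" by (simp add: order_unit_interval_in_ob_base)
  moreover have "(\<lambda>v. u + v) ` {- u..u} \<subseteq> {x. 0 \<le> x}"
  proof clarify
    fix v assume "v \<in> {- u..u}"
    then have "- u \<le> v" by simp
    from add_left_mono[OF this, of u] show "0 \<le> u + v" by simp
  qed
  ultimately show "u \<in> order_bound_topology interior_of {x. 0 \<le> x}"
    unfolding interior_of_order_bound_topology by blast
qed

end
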